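(* Let $\alpha$ be a twisted partial action of a group $G$ on a unital ring $R$ such that every ideal $D_g$ is generated by a central idempotent $1_g$. The center of the partial crossed product $R*_{\alpha}^{w}G$ is $$Z(R*_{\alpha}^{w}G)=\Big\{\sum_{g\in G}r_g\delta_g\ :\ r_{ts^{-1}}w_{ts^{-1},s}=\alpha_s(r_{s^{-1}t}1_{s^{-1}})w_{s,s^{-1}t}\ \text{ and }\ r_s\alpha_s(a1_{s^{-1}})=ar_s,\ \forall a\in R,\ \forall s,t\in G\Big\}.$$
   Context: $G$ is a group with identity $e$ and $R$ is an associative ring with identity $1_R$. A twisted partial action of $G$ on $R$ is a triple $\alpha=(\{D_g\}_{g\in G},\{\alpha_g\}_{g\in G},\{w_{g,h}\}_{(g,h)\in G\times G})$ where each $D_g$ is a two-sided ideal of $R$, $\alpha_g:D_{g^{-1}}\to D_g$ is a ring isomorphism, and $w_{g,h}$ is an invertible element of the multiplier ring of $D_gD_{gh}$, such that for all $g,h,t\in G$: (i) $D_g^2=D_g$ and $D_gD_h=D_hD_g$; (ii) $D_e=R$ and $\alpha_e=\mathrm{id}_R$; (iii) $\alpha_g(D_{g^{-1}}D_h)=D_gD_{gh}$; (iv) $\alpha_g\circ\alpha_h(a)=w_{g,h}\alpha_{gh}(a)w_{g,h}^{-1}$ for all $a\in D_{h^{-1}}D_{h^{-1}g^{-1}}$; (v) $w_{g,e}=w_{e,g}=1$ (the identity multiplier); (vi) $\alpha_g(aw_{h,t})w_{g,ht}=\alpha_g(a)w_{g,h}w_{gh,t}$ for all $a\in D_{g^{-1}}D_hD_{ht}$.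 Standing assumption: each $D_g$ is generated by an idempotent $1_g$ that is central in $R$. Hence $D_gD_{gh}$ is a unital ring with identity $1_g1_{gh}$, $w_{g,h}$ is identified with an invertible element of the ring $D_gD_{gh}$, and $w_{g,e}=w_{e,g}=1_g$. The partial crossed product $R*_{\alpha}^{w}G$ is $\bigoplus_{g\in G}D_g\delta_g$ (the $\delta_g$ are symbols; so elements are finite sums $\sum_g r_g\delta_g$ with $r_g\in D_g$) with the usual addition and multiplication $(a_g\delta_g)(b_h\delta_h)=\alpha_g(\alpha_g^{-1}(a_g)b_h)w_{g,h}\delta_{gh}$; it is an associative ring with identity $1_R\delta_e$. *)

theory Defs
  imports "HOL-Algebra.Ideal_Product"
begin

section \<open>The multiplier ring of an ideal\<close>

text \<open>
  A multiplier \<open>m\<close> of an ideal \<open>I\<close> (seen as a ring, possibly without identity) is a pair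
  \<open>(L, T)\<close> of additive self-maps of \<open>I\<close> with \<open>L (a b) = L a b\<close>, \<open>T (a b) = a (T b)\<close> and
  \<open>T a b = a (L b)\<close>. One writes \<open>m a\<close> for \<open>L a\<close> and \<open>a m\<close> for \<open>T a\<close>, so right actions compose
  from left to right. The maps are taken extensional on \<open>I\<close>, so that equality of multipliers
  is equality of pairs.
\<close>

type_synonym 'b multiplier = "('b \<Rightarrow> 'b) \<times> ('b \<Rightarrow> 'b)"

abbreviation lmul :: "'b multiplier \<Rightarrow> 'b \<Rightarrow> 'b" where
  "lmul m a \<equiv> fst m a"

abbreviation rmul :: "'b \<Rightarrow> 'b multiplier \<Rightarrow> 'b" where
  "rmul a m \<equiv> snd m a"

definition additive_endos :: "('b, 'n) ring_scheme \<Rightarrow> 'b set \<Rightarrow> ('b \<Rightarrow> 'b) set" where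
  "additive_endos R I =
     {f \<in> I \<rightarrow>\<^sub>E I. \<forall>a\<in>I. \<forall>b\<in>I. f (a \<oplus>\<^bsub>R\<^esub> b) = f a \<oplus>\<^bsub>R\<^esub> f b}"

definition multiplier_ring :: "('b, 'n) ring_scheme \<Rightarrow> 'b set \<Rightarrow> 'b multiplier ring" where
  "multiplier_ring R I =
     \<lparr> carrier = {m \<in> additive_endos R I \<times> additive_endos R I.
         \<forall>a\<in>I. \<forall>b\<in>I.
           lmul m (a \<otimes>\<^bsub>R\<^esub> b) = lmul m a \<otimes>\<^bsub>R\<^esub> b \<and>
           rmul (a \<otimes>\<^bsub>R\<^esub> b) m = a \<otimes>\<^bsub>R\<^esub> rmul b m \<and>
           rmul a m \<otimes>\<^bsub>R\<^esub> b = a \<otimes>\<^bsub>R\<^esub> lmul m b},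
       mult = (\<lambda>m m'. (\<lambda>a\<in>I. lmul m (lmul m' a), \<lambda>a\<in>I. rmul (rmul a m) m')),
       one = (\<lambda>a\<in>I. a, \<lambda>a\<in>I. a),
       zero = (\<lambda>a\<in>I. \<zero>\<^bsub>R\<^esub>, \<lambda>a\<in>I. \<zero>\<^bsub>R\<^esub>),
       add = (\<lambda>m m'. (\<lambda>a\<in>I. lmul m a \<oplus>\<^bsub>R\<^esub> lmul m' a,
                       \<lambda>a\<in>I. rmul a m \<oplus>\<^bsub>R\<^esub> rmul a m')) \<rparr>"


section \<open>Twisted partial actions\<close>

text \<open>
  Isomorphisms between ideals as rings not assumed to have an identity; the library's
  \<open>ring_iso\<close> also speaks about the identity elements of the two records.
\<close>

definition ideal_iso :: "('b, 'n) ring_scheme \<Rightarrow> 'b set \<Rightarrow> 'b set \<Rightarrow> ('b \<Rightarrow> 'b) set" where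
  "ideal_iso R I J = {f. bij_betw f I J \<and>
     (\<forall>a\<in>I. \<forall>b\<in>I. f (a \<oplus>\<^bsub>R\<^esub> b) = f a \<oplus>\<^bsub>R\<^esub> f b \<and> f (a \<otimes>\<^bsub>R\<^esub> b) = f a \<otimes>\<^bsub>R\<^esub> f b)}"

text \<open>Only the values of \<open>\<alpha> g\<close> on \<open>D (inv g)\<close> are relevant.\<close>

locale twisted_partial_action = G: group G + R: ring R
  for G :: "('a, 'm) monoid_scheme" and R :: "('b, 'n) ring_scheme" +
  fixes D :: "'a \<Rightarrow> 'b set"
    and \<alpha> :: "'a \<Rightarrow> 'b \<Rightarrow> 'b"
    and w :: "'a \<Rightarrow> 'a \<Rightarrow> 'b multiplier"
  assumes D_ideal:
      "g \<in> carrier G \<Longrightarrow> ideal (D g) R"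
    and \<alpha>_iso:
      "g \<in> carrier G \<Longrightarrow> \<alpha> g \<in> ideal_iso R (D (inv\<^bsub>G\<^esub> g)) (D g)"
    and w_invertible:
      "\<lbrakk>g \<in> carrier G; h \<in> carrier G\<rbrakk>
        \<Longrightarrow> w g h \<in> Units (multiplier_ring R (D g \<cdot>\<^bsub>R\<^esub> D (g \<otimes>\<^bsub>G\<^esub> h)))"
    and D_idem:
      "g \<in> carrier G \<Longrightarrow> D g \<cdot>\<^bsub>R\<^esub> D g = D g"
    and D_commute:
      "\<lbrakk>g \<in> carrier G; h \<in> carrier G\<rbrakk> \<Longrightarrow> D g \<cdot>\<^bsub>R\<^esub> D h = D h \<cdot>\<^bsub>R\<^esub> D g"
    and D_one:
      "D \<one>\<^bsub>G\<^esub> = carrier R"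
    and \<alpha>_one:
      "a \<in> carrier R \<Longrightarrow> \<alpha> \<one>\<^bsub>G\<^esub> a = a"
    and \<alpha>_image:
      "\<lbrakk>g \<in> carrier G; h \<in> carrier G\<rbrakk>
        \<Longrightarrow> \<alpha> g ` (D (inv\<^bsub>G\<^esub> g) \<cdot>\<^bsub>R\<^esub> D h) = D g \<cdot>\<^bsub>R\<^esub> D (g \<otimes>\<^bsub>G\<^esub> h)"
    and \<alpha>_comp:
      "\<lbrakk>g \<in> carrier G; h \<in> carrier G;
        a \<in> D (inv\<^bsub>G\<^esub> h) \<cdot>\<^bsub>R\<^esub> D (inv\<^bsub>G\<^esub> h \<otimes>\<^bsub>G\<^esub> inv\<^bsub>G\<^esub> g)\<rbrakk>
        \<Longrightarrow> \<alpha> g (\<alpha> h a) =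
            rmul (lmul (w g h) (\<alpha> (g \<otimes>\<^bsub>G\<^esub> h) a))
              (inv\<^bsub>multiplier_ring R (D g \<cdot>\<^bsub>R\<^esub> D (g \<otimes>\<^bsub>G\<^esub> h))\<^esub> (w g h))"
    and w_one_right:
      "g \<in> carrier G
        \<Longrightarrow> w g \<one>\<^bsub>G\<^esub> = \<one>\<^bsub>multiplier_ring R (D g \<cdot>\<^bsub>R\<^esub> D (g \<otimes>\<^bsub>G\<^esub> \<one>\<^bsub>G\<^esub>))\<^esub>"
    and w_one_left:
      "g \<in> carrier G
        \<Longrightarrow> w \<one>\<^bsub>G\<^esub> g = \<one>\<^bsub>multiplier_ring R (D \<one>\<^bsub>G\<^esub> \<cdot>\<^bsub>R\<^esub> D (\<one>\<^bsub>G\<^esub> \<otimes>\<^bsub>G\<^esub> g))\<^esub>"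
    and w_cocycle:
      "\<lbrakk>g \<in> carrier G; h \<in> carrier G; t \<in> carrier G;
        a \<in> D (inv\<^bsub>G\<^esub> g) \<cdot>\<^bsub>R\<^esub> D h \<cdot>\<^bsub>R\<^esub> D (h \<otimes>\<^bsub>G\<^esub> t)\<rbrakk>
        \<Longrightarrow> rmul (\<alpha> g (rmul a (w h t))) (w g (h \<otimes>\<^bsub>G\<^esub> t)) =
            rmul (rmul (\<alpha> g a) (w g h)) (w (g \<otimes>\<^bsub>G\<^esub> h) t)"

locale unital_twisted_partial_action = twisted_partial_action G R D \<alpha> w
  for G :: "('a, 'm) monoid_scheme" and R :: "('b, 'n) ring_scheme"
    and D :: "'a \<Rightarrow> 'b set" and \<alpha> :: "'a \<Rightarrow> 'b \<Rightarrow> 'b"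
    and w :: "'a \<Rightarrow> 'a \<Rightarrow> 'b multiplier" +
  fixes u :: "'a \<Rightarrow> 'b"
  assumes u_closed: "g \<in> carrier G \<Longrightarrow> u g \<in> carrier R"
    and u_idem: "g \<in> carrier G \<Longrightarrow> u g \<otimes>\<^bsub>R\<^esub> u g = u g"
    and u_central: "\<lbrakk>g \<in> carrier G; a \<in> carrier R\<rbrakk> \<Longrightarrow> u g \<otimes>\<^bsub>R\<^esub> a = a \<otimes>\<^bsub>R\<^esub> u g"
    and D_generated: "g \<in> carrier G \<Longrightarrow> D g = Idl\<^bsub>R\<^esub> {u g}"

text \<open>
  A multiplier \<open>m\<close> of an ideal with identity \<open>e\<close> is identified with the element \<open>m e = e m\<close> of that
  ideal. The identity of \<open>D g D (g h)\<close> is \<open>u g u (g h)\<close>.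
\<close>

definition twist_elem ::
  "('a, 'm) monoid_scheme \<Rightarrow> ('b, 'n) ring_scheme \<Rightarrow> ('a \<Rightarrow> 'b) \<Rightarrow> ('a \<Rightarrow> 'a \<Rightarrow> 'b multiplier)
    \<Rightarrow> 'a \<Rightarrow> 'a \<Rightarrow> 'b" where
  "twist_elem G R u w g h = lmul (w g h) (u g \<otimes>\<^bsub>R\<^esub> u (g \<otimes>\<^bsub>G\<^esub> h))"


section \<open>The partial crossed product and the center of a ring\<close>

text \<open>
  The formal sum of the \<open>r g \<delta>\<^sub>g\<close> is represented by its coefficient function \<open>r\<close>, extensional on
  \<open>carrier G\<close>. The product is the biadditive extension of
  \<open>(a \<delta>\<^sub>g) (b \<delta>\<^sub>h) = \<alpha>\<^sub>g (\<alpha>\<^sub>g\<^sup>-\<^sup>1 a b) w\<^sub>g\<^sub>,\<^sub>h \<delta>\<^sub>g\<^sub>h\<close>: its coefficient at \<open>k\<close> collects the finitely many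
  pairs \<open>(g, h)\<close> in the supports of the factors with \<open>g h = k\<close>.
\<close>

definition coeff_support ::
  "('a, 'm) monoid_scheme \<Rightarrow> ('b, 'n) ring_scheme \<Rightarrow> ('a \<Rightarrow> 'b) \<Rightarrow> 'a set" where
  "coeff_support G R r = {g \<in> carrier G. r g \<noteq> \<zero>\<^bsub>R\<^esub>}"

definition partial_crossed_product ::
  "('a, 'm) monoid_scheme \<Rightarrow> ('b, 'n) ring_scheme \<Rightarrow> ('a \<Rightarrow> 'b set) \<Rightarrow> ('a \<Rightarrow> 'b \<Rightarrow> 'b)
    \<Rightarrow> ('a \<Rightarrow> 'a \<Rightarrow> 'b multiplier) \<Rightarrow> ('a \<Rightarrow> 'b) ring" where
  "partial_crossed_product G R D \<alpha> w =
     \<lparr> carrier = {r \<in> \<Pi>\<^sub>E g\<in>carrier G. D g. finite (coeff_support G R r)},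
       mult = (\<lambda>a b. \<lambda>k\<in>carrier G.
         finsum R
           (\<lambda>(g, h). rmul (\<alpha> g (inv_into (D (inv\<^bsub>G\<^esub> g)) (\<alpha> g) (a g) \<otimes>\<^bsub>R\<^esub> b h)) (w g h))
           {(g, h) \<in> coeff_support G R a \<times> coeff_support G R b. g \<otimes>\<^bsub>G\<^esub> h = k}),
       one = (\<lambda>g\<in>carrier G. if g = \<one>\<^bsub>G\<^esub> then \<one>\<^bsub>R\<^esub> else \<zero>\<^bsub>R\<^esub>),
       zero = (\<lambda>g\<in>carrier G. \<zero>\<^bsub>R\<^esub>),
       add = (\<lambda>a b. \<lambda>g\<in>carrier G. a g \<oplus>\<^bsub>R\<^esub> b g) \<rparr>"

definition ring_center :: "('c, 'n) ring_scheme \<Rightarrow> 'c set" where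
  "ring_center S = {z \<in> carrier S. \<forall>x\<in>carrier S. z \<otimes>\<^bsub>S\<^esub> x = x \<otimes>\<^bsub>S\<^esub> z}"

end

theory Submission
  imports Defs
begin

text \<open>
  The \<open>k\<close>-th coefficient of a product \<open>a b\<close> is a sum of terms \<open>a\<^sub>g \<alpha>\<^sub>g (b\<^sub>h 1\<^bsub>g\<inverse>\<^esub>) w\<^sub>g\<^sub>,\<^sub>h\<close> with \<open>g h = k\<close>,
  which can be indexed by the support of either factor. Commuting with \<open>a \<delta>\<^sub>e\<close> and with \<open>1\<^sub>s \<delta>\<^sub>s\<close> gives
  the two conditions on \<open>r\<close>; conversely they turn \<open>r\<^sub>g \<alpha>\<^sub>g (a\<^sub>h 1\<^bsub>g\<inverse>\<^esub>) w\<^sub>g\<^sub>,\<^sub>h\<close> into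
  \<open>a\<^sub>h \<alpha>\<^sub>h (r\<^sub>f 1\<^bsub>h\<inverse>\<^esub>) w\<^sub>h\<^sub>,\<^sub>f\<close> with \<open>h f = g h\<close>, so the two products agree term by term.
\<close>

section \<open>Ideals generated by a central idempotent and their multipliers\<close>

context ring
begin

text \<open>Centrality of \<open>e\<close> makes the fixed points of multiplication by
  \<open>e\<close> a two-sided ideal; it contains \<open>e\<close> by idempotence, and each of its
  elements is a multiple of \<open>e\<close>. Membership in each \<open>D g\<close> thus becomes an
  equation that the simplifier can use.\<close>

lemma genideal_central_idem:
  assumes "e \<in> carrier R" "e \<otimes> e = e" "\<And>a. a \<in> carrier R \<Longrightarrow> e \<otimes> a = a \<otimes> e"
  shows "Idl {e} = {a \<in> carrier R. e \<otimes> a = a}" (is "_ = ?I")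
proof
  have "subgroup ?I (add_monoid R)"
    using assms(1) by unfold_locales (auto simp: r_distr r_minus simp flip: a_inv_def)
  moreover have "x \<otimes> a \<in> ?I" "a \<otimes> x \<in> ?I" if a: "a \<in> ?I" and x: "x \<in> carrier R" for a x
  proof -
    \<comment> \<open>Only multiplication from the left needs centrality: \<open>e\<close> must pass
      \<open>x\<close> to reach \<open>a\<close>.\<close>
    have "e \<otimes> (x \<otimes> a) = x \<otimes> e \<otimes> a"
      using a x assms(1) assms(3)[OF x] m_assoc[of e x a] by simp
    also have "\<dots> = x \<otimes> a" using a x assms(1) by (simp add: m_assoc)
    finally show "x \<otimes> a \<in> ?I" using a x by simp
    show "a \<otimes> x \<in> ?I" using a x assms(1) m_assoc[of e a x] by simp
  qed
  ultimately have "ideal ?I R" by (intro idealI ring_axioms)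
  then show "Idl {e} \<subseteq> ?I" using assms(1,2) by (intro genideal_minimal) auto
  show "?I \<subseteq> Idl {e}"
  proof
    fix a assume a: "a \<in> ?I"
    have "e \<otimes> a \<in> Idl {e}"
      using a assms(1) genideal_ideal[of "{e}"] genideal_self'[of e] ideal.I_r_closed[of "Idl {e}" R e a]
      by simp
    then show "a \<in> Idl {e}" using a by simp
  qed
qed

end

lemma Units_multiplier_ringD:
  "m \<in> Units (multiplier_ring R I) \<Longrightarrow> m \<in> carrier (multiplier_ring R I)"
  by (simp add: Units_def)

text \<open>Since \<open>rmul a m\<close> stays in \<open>I\<close>, it may be multiplied by
  \<open>e\<close> on the right; the compatibility law (a m) e = a (m e) then moves the multiplier
  onto \<open>e\<close>. This justifies replacing a multiplier by the element
  \<open>lmul m e\<close>.\<close>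

lemma (in ring) rmul_eq_mult:
  assumes m: "m \<in> carrier (multiplier_ring R I)" and I: "I \<subseteq> carrier R"
    and e: "e \<in> I" and id: "\<And>a. a \<in> I \<Longrightarrow> e \<otimes> a = a \<and> a \<otimes> e = a" and a: "a \<in> I"
  shows "rmul a m = a \<otimes> lmul m e"
proof -
  have "rmul a m \<in> I"
    using m a by (auto simp: multiplier_ring_def additive_endos_def)
  then have "rmul a m = rmul a m \<otimes> e" using id by simp
  also have "\<dots> = a \<otimes> lmul m e" using m a e by (auto simp: multiplier_ring_def)
  finally show ?thesis .
qed

section \<open>The ideals \<open>D g\<close> and their identities \<open>u g\<close>\<close>

context unital_twisted_partial_action
begin

abbreviation crossed_product where
  "crossed_product \<equiv> partial_crossed_product G R D \<alpha> w"

abbreviation twist where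
  "twist \<equiv> twist_elem G R u w"

declare u_closed [simp]

lemma D_eq: "g \<in> carrier G \<Longrightarrow> D g = {a \<in> carrier R. u g \<otimes>\<^bsub>R\<^esub> a = a}"
  unfolding D_generated by (intro R.genideal_central_idem u_closed u_idem u_central)

text \<open>An element \<open>a\<close> of the intersection is the product of \<open>u g\<close> in
  \<open>D g\<close> and \<open>a\<close> itself in \<open>D h\<close>. Products of these ideals can
  therefore be handled as intersections throughout.\<close>

lemma D_prod_eq:
  assumes "g \<in> carrier G" "h \<in> carrier G"
  shows "D g \<cdot>\<^bsub>R\<^esub> D h = D g \<inter> D h"
proof
  show "D g \<cdot>\<^bsub>R\<^esub> D h \<subseteq> D g \<inter> D h"
    using R.ideal_prod_inter[OF D_ideal D_ideal] assms by simp
  show "D g \<inter> D h \<subseteq> D g \<cdot>\<^bsub>R\<^esub> D h"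
  proof
    fix a assume a: "a \<in> D g \<inter> D h"
    have "u g \<in> D g" using assms by (simp add: D_eq u_idem)
    then have "u g \<otimes>\<^bsub>R\<^esub> a \<in> D g \<cdot>\<^bsub>R\<^esub> D h" using a by (intro ideal_prod.prod) auto
    then show "a \<in> D g \<cdot>\<^bsub>R\<^esub> D h" using a assms by (simp add: D_eq)
  qed
qed

lemma
  assumes "g \<in> carrier G" "a \<in> D g"
  shows D_carrier: "a \<in> carrier R"
    and u_mult: "u g \<otimes>\<^bsub>R\<^esub> a = a"
    and mult_u: "a \<otimes>\<^bsub>R\<^esub> u g = a"
proof -
  show a: "a \<in> carrier R" and "u g \<otimes>\<^bsub>R\<^esub> a = a" using assms D_eq by blast+
  then show "a \<otimes>\<^bsub>R\<^esub> u g = a" using u_central[OF assms(1) a] by simp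
qed

lemma
  assumes "g \<in> carrier G" "a \<in> D g" "x \<in> carrier R"
  shows D_mult_right: "a \<otimes>\<^bsub>R\<^esub> x \<in> D g"
    and D_mult_left: "x \<otimes>\<^bsub>R\<^esub> a \<in> D g"
  by (rule ideal.I_r_closed[OF D_ideal[OF assms(1)] assms(2,3)],
      rule ideal.I_l_closed[OF D_ideal[OF assms(1)] assms(2,3)])

lemma zero_in_D: "g \<in> carrier G \<Longrightarrow> \<zero>\<^bsub>R\<^esub> \<in> D g"
  by (simp add: D_eq)

lemma u_in_D: "g \<in> carrier G \<Longrightarrow> u g \<in> D g"
  by (simp add: D_eq u_idem)

lemma u_one: "u \<one>\<^bsub>G\<^esub> = \<one>\<^bsub>R\<^esub>"
  using mult_u[of "\<one>\<^bsub>G\<^esub>" "\<one>\<^bsub>R\<^esub>"] by (simp add: D_one)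

section \<open>The isomorphisms \<open>\<alpha> g\<close> and their effect on identities\<close>

lemma \<alpha>_bij: "g \<in> carrier G \<Longrightarrow> bij_betw (\<alpha> g) (D (inv\<^bsub>G\<^esub> g)) (D g)"
  using \<alpha>_iso[of g] by (simp add: ideal_iso_def)

lemma \<alpha>_closed: "\<lbrakk>g \<in> carrier G; a \<in> D (inv\<^bsub>G\<^esub> g)\<rbrakk> \<Longrightarrow> \<alpha> g a \<in> D g"
  using bij_betwE[OF \<alpha>_bij] by blast

lemma \<alpha>_mult:
  "\<lbrakk>g \<in> carrier G; a \<in> D (inv\<^bsub>G\<^esub> g); b \<in> D (inv\<^bsub>G\<^esub> g)\<rbrakk> \<Longrightarrow> \<alpha> g (a \<otimes>\<^bsub>R\<^esub> b) = \<alpha> g a \<otimes>\<^bsub>R\<^esub> \<alpha> g b"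
  using \<alpha>_iso[of g] by (simp add: ideal_iso_def)

lemma \<alpha>_zero:
  assumes "g \<in> carrier G"
  shows "\<alpha> g \<zero>\<^bsub>R\<^esub> = \<zero>\<^bsub>R\<^esub>"
proof -
  have z: "\<zero>\<^bsub>R\<^esub> \<in> D (inv\<^bsub>G\<^esub> g)" using assms by (simp add: zero_in_D)
  then have "\<alpha> g (\<zero>\<^bsub>R\<^esub> \<oplus>\<^bsub>R\<^esub> \<zero>\<^bsub>R\<^esub>) = \<alpha> g \<zero>\<^bsub>R\<^esub> \<oplus>\<^bsub>R\<^esub> \<alpha> g \<zero>\<^bsub>R\<^esub>"
    using \<alpha>_iso[OF assms] unfolding ideal_iso_def by blast
  moreover have "\<alpha> g \<zero>\<^bsub>R\<^esub> \<in> carrier R"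
    using \<alpha>_closed[OF assms z] D_carrier assms by blast
  ultimately show ?thesis by (simp add: R.add.l_cancel_one')
qed

lemma restrict_closed:
  assumes "g \<in> carrier G" "a \<in> carrier R"
  shows "a \<otimes>\<^bsub>R\<^esub> u g \<in> D g"
  using assms by (simp add: D_mult_left u_in_D)

lemma \<alpha>_image_Int:
  assumes "g \<in> carrier G" "h \<in> carrier G"
  shows "\<alpha> g ` (D (inv\<^bsub>G\<^esub> g) \<inter> D h) = D g \<inter> D (g \<otimes>\<^bsub>G\<^esub> h)"
  using \<alpha>_image[OF assms] assms by (simp add: D_prod_eq)

text \<open>A multiplicative map sends the identity of an ideal to an identity of its image. Here
  \<open>\<alpha> g\<close> maps the intersection of \<open>D (inv g)\<close> and \<open>D h\<close>
  onto that of \<open>D g\<close> and \<open>D (g h)\<close>, and both sides are the respective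
  identities.\<close>

lemma \<alpha>_unit:
  assumes g: "g \<in> carrier G" and h: "h \<in> carrier G"
  shows "\<alpha> g (u h \<otimes>\<^bsub>R\<^esub> u (inv\<^bsub>G\<^esub> g)) = u g \<otimes>\<^bsub>R\<^esub> u (g \<otimes>\<^bsub>G\<^esub> h)"
proof -
  let ?x = "u h \<otimes>\<^bsub>R\<^esub> u (inv\<^bsub>G\<^esub> g)" and ?e = "u g \<otimes>\<^bsub>R\<^esub> u (g \<otimes>\<^bsub>G\<^esub> h)"
  have x: "?x \<in> D (inv\<^bsub>G\<^esub> g) \<inter> D h" using g h by (simp add: D_mult_left D_mult_right u_in_D)
  have e: "?e \<in> D g \<inter> D (g \<otimes>\<^bsub>G\<^esub> h)" using g h by (simp add: D_mult_left D_mult_right u_in_D)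
  \<comment> \<open>Uniqueness of the identity: \<open>?x\<close> fixes the preimage
    \<open>y\<close> of \<open>?e\<close>, so \<open>\<alpha> g ?x\<close> times \<open>?e\<close>
    is \<open>?e\<close>. As \<open>?e\<close> is also a right identity for
    \<open>\<alpha> g ?x\<close>, the two coincide.\<close>
  obtain y where y: "y \<in> D (inv\<^bsub>G\<^esub> g) \<inter> D h" "\<alpha> g y = ?e"
    using e \<alpha>_image_Int[OF g h] by (metis imageE)
  have \<alpha>x: "\<alpha> g ?x \<in> D g \<inter> D (g \<otimes>\<^bsub>G\<^esub> h)" using x \<alpha>_image_Int[OF g h] by blast
  have "?x \<otimes>\<^bsub>R\<^esub> y = y"
    using y(1) g h D_carrier[of h y] by (simp add: R.m_assoc u_mult)
  then have "?e = \<alpha> g ?x \<otimes>\<^bsub>R\<^esub> ?e"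
    using \<alpha>_mult[of g ?x y] g x y by simp
  also have "\<dots> = \<alpha> g ?x"
    using \<alpha>x g h D_carrier[of g "\<alpha> g ?x"] by (simp add: mult_u flip: R.m_assoc)
  finally show ?thesis by simp
qed

section \<open>The twists as elements of the ring\<close>

text \<open>The product of \<open>u g\<close> and \<open>u (g h)\<close> is the identity of the
  ideal on which \<open>w g h\<close> acts, so the right action of the multiplier is multiplication
  by its value there.\<close>

lemma
  assumes g: "g \<in> carrier G" and h: "h \<in> carrier G"
  shows twist_in_D: "twist g h \<in> D g \<inter> D (g \<otimes>\<^bsub>G\<^esub> h)"
    and rmul_twist: "a \<in> D g \<inter> D (g \<otimes>\<^bsub>G\<^esub> h) \<Longrightarrow> rmul a (w g h) = a \<otimes>\<^bsub>R\<^esub> twist g h"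
proof -
  let ?I = "D g \<inter> D (g \<otimes>\<^bsub>G\<^esub> h)" and ?e = "u g \<otimes>\<^bsub>R\<^esub> u (g \<otimes>\<^bsub>G\<^esub> h)"
  have m: "w g h \<in> carrier (multiplier_ring R ?I)"
    using Units_multiplier_ringD[OF w_invertible[OF g h]] g h by (simp add: D_prod_eq)
  have e: "?e \<in> ?I" using g h by (simp add: D_mult_left D_mult_right u_in_D)
  show "twist g h \<in> ?I"
    using m e unfolding twist_elem_def by (auto simp: multiplier_ring_def additive_endos_def)
  have id: "?e \<otimes>\<^bsub>R\<^esub> a = a \<and> a \<otimes>\<^bsub>R\<^esub> ?e = a" if "a \<in> ?I" for a
  proof
    have a: "a \<in> carrier R" using that g D_carrier by blast
    show "?e \<otimes>\<^bsub>R\<^esub> a = a" using a that g h by (simp add: R.m_assoc u_mult)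
    show "a \<otimes>\<^bsub>R\<^esub> ?e = a" using a that g h by (simp add: mult_u flip: R.m_assoc)
  qed
  have "?I \<subseteq> carrier R" using g D_carrier by blast
  then show "rmul a (w g h) = a \<otimes>\<^bsub>R\<^esub> twist g h" if "a \<in> ?I"
    unfolding twist_elem_def using R.rmul_eq_mult[OF m _ e id that] by blast
qed

lemma twist_carrier [simp]: "\<lbrakk>g \<in> carrier G; h \<in> carrier G\<rbrakk> \<Longrightarrow> twist g h \<in> carrier R"
  using twist_in_D D_carrier by blast

text \<open>The identity multiplier fixes the identity of \<open>D g\<close>, which is
  \<open>u g\<close> times itself.\<close>

lemma twist_one_right: "g \<in> carrier G \<Longrightarrow> twist g \<one>\<^bsub>G\<^esub> = u g"
  using w_one_right[of g]
  by (simp add: twist_elem_def D_prod_eq multiplier_ring_def u_idem u_in_D)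

lemma twist_one_left: "g \<in> carrier G \<Longrightarrow> twist \<one>\<^bsub>G\<^esub> g = u g"
  using w_one_left[of g] D_prod_eq[of "\<one>\<^bsub>G\<^esub>" g]
  by (simp add: twist_elem_def multiplier_ring_def u_one u_in_D D_one)

section \<open>Coefficients of products\<close>

text \<open>The coefficient of (a_g \<delta>_g)(b_h \<delta>_h), rewritten without the inverse of
  \<open>\<alpha> g\<close> and with the multiplier turned into a ring element. The factor
  \<open>u (inv g)\<close> forces the argument of \<open>\<alpha> g\<close> into its domain.\<close>

definition mult_term :: "('a \<Rightarrow> 'b) \<Rightarrow> ('a \<Rightarrow> 'b) \<Rightarrow> 'a \<Rightarrow> 'a \<Rightarrow> 'b" where
  "mult_term a b g h = a g \<otimes>\<^bsub>R\<^esub> \<alpha> g (b h \<otimes>\<^bsub>R\<^esub> u (inv\<^bsub>G\<^esub> g)) \<otimes>\<^bsub>R\<^esub> twist g h"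

lemma crossed_carrierD:
  assumes "a \<in> carrier crossed_product"
  shows "g \<in> carrier G \<Longrightarrow> a g \<in> D g" "finite (coeff_support G R a)"
  using assms by (auto simp: partial_crossed_product_def)

lemma crossed_coeff [simp]:
  "\<lbrakk>a \<in> carrier crossed_product; g \<in> carrier G\<rbrakk> \<Longrightarrow> a g \<in> carrier R"
  using crossed_carrierD D_carrier by blast

lemma \<alpha>_restrict_carrier [simp]:
  "\<lbrakk>g \<in> carrier G; x \<in> carrier R\<rbrakk> \<Longrightarrow> \<alpha> g (x \<otimes>\<^bsub>R\<^esub> u (inv\<^bsub>G\<^esub> g)) \<in> carrier R"
  using \<alpha>_closed D_carrier restrict_closed by (meson G.inv_closed)

lemma mult_term_closed [simp]:
  assumes "a \<in> carrier crossed_product" "b \<in> carrier crossed_product" "g \<in> carrier G" "h \<in> carrier G"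
  shows "mult_term a b g h \<in> carrier R"
  using assms by (simp add: mult_term_def)

text \<open>This permits index sets larger than the supports.\<close>

lemma mult_term_zero:
  assumes "a \<in> carrier crossed_product" "b \<in> carrier crossed_product" "g \<in> carrier G" "h \<in> carrier G"
    and "a g = \<zero>\<^bsub>R\<^esub> \<or> b h = \<zero>\<^bsub>R\<^esub>"
  shows "mult_term a b g h = \<zero>\<^bsub>R\<^esub>"
  using assms(5)
proof
  assume "a g = \<zero>\<^bsub>R\<^esub>"
  then show ?thesis using assms by (simp add: mult_term_def)
next
  assume "b h = \<zero>\<^bsub>R\<^esub>"
  then show ?thesis using assms by (simp add: mult_term_def \<alpha>_zero)
qed

text \<open>Let z be the preimage of \<open>x\<close>. It absorbs \<open>u (inv g)\<close>, so z y =
  z (y \<open>u (inv g)\<close>), where, unlike \<open>y\<close>, the second factor lies in the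
  domain of \<open>\<alpha> g\<close>. Multiplicativity then turns z back into
  \<open>x\<close>.\<close>

lemma monomial_product:
  assumes g: "g \<in> carrier G" and h: "h \<in> carrier G" and x: "x \<in> D g" and y: "y \<in> D h"
  shows "rmul (\<alpha> g (inv_into (D (inv\<^bsub>G\<^esub> g)) (\<alpha> g) x \<otimes>\<^bsub>R\<^esub> y)) (w g h) =
    x \<otimes>\<^bsub>R\<^esub> \<alpha> g (y \<otimes>\<^bsub>R\<^esub> u (inv\<^bsub>G\<^esub> g)) \<otimes>\<^bsub>R\<^esub> twist g h"
proof -
  define z where "z = inv_into (D (inv\<^bsub>G\<^esub> g)) (\<alpha> g) x"
  have z: "z \<in> D (inv\<^bsub>G\<^esub> g)" and \<alpha>z: "\<alpha> g z = x"
    unfolding z_def using \<alpha>_bij[OF g] x by (auto simp: bij_betw_def inv_into_into f_inv_into_f)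
  have carr: "z \<in> carrier R" "y \<in> carrier R" using D_carrier[OF _ z] D_carrier[OF h y] g by auto
  have "z \<otimes>\<^bsub>R\<^esub> y = z \<otimes>\<^bsub>R\<^esub> (y \<otimes>\<^bsub>R\<^esub> u (inv\<^bsub>G\<^esub> g))"
    using carr g mult_u[OF _ z] u_central[of "inv\<^bsub>G\<^esub> g" y]
    by (metis G.inv_closed R.m_assoc u_closed)
  then have eq: "\<alpha> g (z \<otimes>\<^bsub>R\<^esub> y) = x \<otimes>\<^bsub>R\<^esub> \<alpha> g (y \<otimes>\<^bsub>R\<^esub> u (inv\<^bsub>G\<^esub> g))"
    using \<alpha>_mult[OF g z restrict_closed[of "inv\<^bsub>G\<^esub> g" y]] g carr \<alpha>z by simp
  \<comment> \<open>The image of this product under \<open>\<alpha> g\<close> lies in the ideal of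
    \<open>w g h\<close>, where the right action is multiplication by the twist.\<close>
  have "z \<otimes>\<^bsub>R\<^esub> y \<in> D (inv\<^bsub>G\<^esub> g) \<inter> D h"
    using carr z y g h by (simp add: D_mult_left D_mult_right)
  then have "\<alpha> g (z \<otimes>\<^bsub>R\<^esub> y) \<in> D g \<inter> D (g \<otimes>\<^bsub>G\<^esub> h)"
    using \<alpha>_image_Int[OF g h] by blast
  then show ?thesis using rmul_twist[OF g h] eq by (simp add: z_def)
qed

lemma crossed_mult_eq:
  assumes a: "a \<in> carrier crossed_product" and b: "b \<in> carrier crossed_product" and k: "k \<in> carrier G"
  shows "(a \<otimes>\<^bsub>crossed_product\<^esub> b) k =
    finsum R (\<lambda>(g, h). mult_term a b g h)
      {(g, h) \<in> coeff_support G R a \<times> coeff_support G R b. g \<otimes>\<^bsub>G\<^esub> h = k}" (is "_ = finsum R _ ?P")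
proof -
  have eq: "rmul (\<alpha> g (inv_into (D (inv\<^bsub>G\<^esub> g)) (\<alpha> g) (a g) \<otimes>\<^bsub>R\<^esub> b h)) (w g h) = mult_term a b g h"
    if "(g, h) \<in> ?P" for g h
    using that monomial_product[of g h "a g" "b h"] crossed_carrierD(1)[OF a] crossed_carrierD(1)[OF b]
    by (auto simp: mult_term_def coeff_support_def)
  have "finsum R (\<lambda>(g, h). rmul (\<alpha> g (inv_into (D (inv\<^bsub>G\<^esub> g)) (\<alpha> g) (a g) \<otimes>\<^bsub>R\<^esub> b h)) (w g h)) ?P
    = finsum R (\<lambda>(g, h). mult_term a b g h) ?P"
    by (rule R.add.finprod_cong') (use eq a b in \<open>auto simp: coeff_support_def\<close>)
  then show ?thesis using k by (simp add: partial_crossed_product_def)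
qed

text \<open>In a group, \<open>h\<close> and the product \<open>k\<close> determine the left index
  as k h^-1, so the sum over pairs becomes a sum over \<open>h\<close>. Any finite \<open>F\<close>
  containing the support of \<open>b\<close> serves, since the extra terms vanish.\<close>

lemma crossed_mult_right:
  assumes a: "a \<in> carrier crossed_product" and b: "b \<in> carrier crossed_product" and k: "k \<in> carrier G"
    and F: "finite F" "coeff_support G R b \<subseteq> F" "F \<subseteq> carrier G"
  shows "(a \<otimes>\<^bsub>crossed_product\<^esub> b) k = finsum R (\<lambda>h. mult_term a b (k \<otimes>\<^bsub>G\<^esub> inv\<^bsub>G\<^esub> h) h) F"
proof -
  let ?f = "\<lambda>h. (k \<otimes>\<^bsub>G\<^esub> inv\<^bsub>G\<^esub> h, h)"
  have "(a \<otimes>\<^bsub>crossed_product\<^esub> b) k = finsum R (\<lambda>(g, h). mult_term a b g h) (?f ` F)"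
    unfolding crossed_mult_eq[OF a b k]
  proof (rule R.add.finprod_mono_neutral_cong_left)
    show "{(g, h) \<in> coeff_support G R a \<times> coeff_support G R b. g \<otimes>\<^bsub>G\<^esub> h = k} \<subseteq> ?f ` F"
      using F k by (force simp: coeff_support_def G.inv_solve_right)
  next
    \<comment> \<open>Each pair in the image has product \<open>k\<close>; if it is not in the
      original index set, one of its two coefficients is zero.\<close>
    fix p assume "p \<in> ?f ` F - {(g, h) \<in> coeff_support G R a \<times> coeff_support G R b. g \<otimes>\<^bsub>G\<^esub> h = k}"
    then show "(case p of (g, h) \<Rightarrow> mult_term a b g h) = \<zero>\<^bsub>R\<^esub>"
      using F k by (auto simp: coeff_support_def G.m_assoc subset_iff intro!: mult_term_zero[OF a b])
  qed (use F k a b in auto)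
  also have "\<dots> = finsum R (\<lambda>h. mult_term a b (k \<otimes>\<^bsub>G\<^esub> inv\<^bsub>G\<^esub> h) h) F"
    using F k a b by (subst R.add.finprod_reindex) (auto simp: inj_on_def)
  finally show ?thesis .
qed

text \<open>The mirror image, indexed by the left factor: the right index is g^-1 k.\<close>

lemma crossed_mult_left:
  assumes a: "a \<in> carrier crossed_product" and b: "b \<in> carrier crossed_product" and k: "k \<in> carrier G"
    and F: "finite F" "coeff_support G R a \<subseteq> F" "F \<subseteq> carrier G"
  shows "(a \<otimes>\<^bsub>crossed_product\<^esub> b) k = finsum R (\<lambda>g. mult_term a b g (inv\<^bsub>G\<^esub> g \<otimes>\<^bsub>G\<^esub> k)) F"
proof -
  let ?f = "\<lambda>g. (g, inv\<^bsub>G\<^esub> g \<otimes>\<^bsub>G\<^esub> k)"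
  have "(a \<otimes>\<^bsub>crossed_product\<^esub> b) k = finsum R (\<lambda>(g, h). mult_term a b g h) (?f ` F)"
    unfolding crossed_mult_eq[OF a b k]
  proof (rule R.add.finprod_mono_neutral_cong_left)
    show "{(g, h) \<in> coeff_support G R a \<times> coeff_support G R b. g \<otimes>\<^bsub>G\<^esub> h = k} \<subseteq> ?f ` F"
      using F k by (force simp: coeff_support_def G.inv_solve_left)
  next
    fix p assume "p \<in> ?f ` F - {(g, h) \<in> coeff_support G R a \<times> coeff_support G R b. g \<otimes>\<^bsub>G\<^esub> h = k}"
    then show "(case p of (g, h) \<Rightarrow> mult_term a b g h) = \<zero>\<^bsub>R\<^esub>"
      using F k by (auto simp: coeff_support_def subset_iff simp flip: G.m_assoc intro!: mult_term_zero[OF a b])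
  qed (use F k a b in auto)
  also have "\<dots> = finsum R (\<lambda>g. mult_term a b g (inv\<^bsub>G\<^esub> g \<otimes>\<^bsub>G\<^esub> k)) F"
    using F k a b by (subst R.add.finprod_reindex) (auto simp: inj_on_def)
  finally show ?thesis .
qed

section \<open>Multiplication by homogeneous elements\<close>

text \<open>The element x \<delta>_s of the crossed product, for \<open>x\<close> in
  \<open>D s\<close>.\<close>

definition monomial :: "'b \<Rightarrow> 'a \<Rightarrow> 'a \<Rightarrow> 'b" where
  "monomial x s = (\<lambda>g\<in>carrier G. if g = s then x else \<zero>\<^bsub>R\<^esub>)"

lemma coeff_support_monomial: "coeff_support G R (monomial x s) \<subseteq> {s}"
  by (auto simp: coeff_support_def monomial_def)

lemma monomial_closed:
  assumes "s \<in> carrier G" "x \<in> D s"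
  shows "monomial x s \<in> carrier crossed_product"
  using assms finite_subset[OF coeff_support_monomial[where x = x and s = s]]
  by (auto simp: partial_crossed_product_def monomial_def zero_in_D)

text \<open>The support of the monomial lies in \<open>{s}\<close>, so indexing each product by that
  factor leaves a single summand.\<close>

lemma mult_monomial:
  assumes r: "r \<in> carrier crossed_product" and s: "s \<in> carrier G" and x: "x \<in> D s" and k: "k \<in> carrier G"
  shows "(r \<otimes>\<^bsub>crossed_product\<^esub> monomial x s) k =
      r (k \<otimes>\<^bsub>G\<^esub> inv\<^bsub>G\<^esub> s) \<otimes>\<^bsub>R\<^esub> \<alpha> (k \<otimes>\<^bsub>G\<^esub> inv\<^bsub>G\<^esub> s) (x \<otimes>\<^bsub>R\<^esub> u (inv\<^bsub>G\<^esub> (k \<otimes>\<^bsub>G\<^esub> inv\<^bsub>G\<^esub> s)))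
        \<otimes>\<^bsub>R\<^esub> twist (k \<otimes>\<^bsub>G\<^esub> inv\<^bsub>G\<^esub> s) s"
    and "(monomial x s \<otimes>\<^bsub>crossed_product\<^esub> r) k =
      x \<otimes>\<^bsub>R\<^esub> \<alpha> s (r (inv\<^bsub>G\<^esub> s \<otimes>\<^bsub>G\<^esub> k) \<otimes>\<^bsub>R\<^esub> u (inv\<^bsub>G\<^esub> s)) \<otimes>\<^bsub>R\<^esub> twist s (inv\<^bsub>G\<^esub> s \<otimes>\<^bsub>G\<^esub> k)"
proof -
  note m = monomial_closed[OF s x]
  \<comment> \<open>Evaluating a sum over a singleton requires its summand to lie in the
    carrier.\<close>
  have "mult_term r (monomial x s) (k \<otimes>\<^bsub>G\<^esub> inv\<^bsub>G\<^esub> s) s \<in> carrier R"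
    "mult_term (monomial x s) r s (inv\<^bsub>G\<^esub> s \<otimes>\<^bsub>G\<^esub> k) \<in> carrier R"
    using m r s k by simp_all
  then show "(r \<otimes>\<^bsub>crossed_product\<^esub> monomial x s) k =
      r (k \<otimes>\<^bsub>G\<^esub> inv\<^bsub>G\<^esub> s) \<otimes>\<^bsub>R\<^esub> \<alpha> (k \<otimes>\<^bsub>G\<^esub> inv\<^bsub>G\<^esub> s) (x \<otimes>\<^bsub>R\<^esub> u (inv\<^bsub>G\<^esub> (k \<otimes>\<^bsub>G\<^esub> inv\<^bsub>G\<^esub> s)))
        \<otimes>\<^bsub>R\<^esub> twist (k \<otimes>\<^bsub>G\<^esub> inv\<^bsub>G\<^esub> s) s"
    and "(monomial x s \<otimes>\<^bsub>crossed_product\<^esub> r) k =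
      x \<otimes>\<^bsub>R\<^esub> \<alpha> s (r (inv\<^bsub>G\<^esub> s \<otimes>\<^bsub>G\<^esub> k) \<otimes>\<^bsub>R\<^esub> u (inv\<^bsub>G\<^esub> s)) \<otimes>\<^bsub>R\<^esub> twist s (inv\<^bsub>G\<^esub> s \<otimes>\<^bsub>G\<^esub> k)"
    using crossed_mult_right[OF r m k _ coeff_support_monomial]
      crossed_mult_left[OF m r k _ coeff_support_monomial] s
    by (simp_all add: mult_term_def) (simp_all add: monomial_def)
qed

section \<open>The two inclusions for the center\<close>

text \<open>The first condition is the coefficient at \<open>t\<close> of commutation with
  \<open>monomial (u s) s\<close>; the second is the coefficient at \<open>s\<close> of commutation
  with a \<delta>_e, which is available for every \<open>a\<close> because D_e is the whole
  ring.\<close>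

lemma central_imp_conditions:
  assumes "r \<in> ring_center crossed_product"
  shows "\<lbrakk>s \<in> carrier G; t \<in> carrier G\<rbrakk> \<Longrightarrow>
      r (t \<otimes>\<^bsub>G\<^esub> inv\<^bsub>G\<^esub> s) \<otimes>\<^bsub>R\<^esub> twist (t \<otimes>\<^bsub>G\<^esub> inv\<^bsub>G\<^esub> s) s =
      \<alpha> s (r (inv\<^bsub>G\<^esub> s \<otimes>\<^bsub>G\<^esub> t) \<otimes>\<^bsub>R\<^esub> u (inv\<^bsub>G\<^esub> s)) \<otimes>\<^bsub>R\<^esub> twist s (inv\<^bsub>G\<^esub> s \<otimes>\<^bsub>G\<^esub> t)"
    and "\<lbrakk>a \<in> carrier R; s \<in> carrier G\<rbrakk> \<Longrightarrow> r s \<otimes>\<^bsub>R\<^esub> \<alpha> s (a \<otimes>\<^bsub>R\<^esub> u (inv\<^bsub>G\<^esub> s)) = a \<otimes>\<^bsub>R\<^esub> r s"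
proof -
  have r: "r \<in> carrier crossed_product" using assms by (simp add: ring_center_def)
  have comm: "r \<otimes>\<^bsub>crossed_product\<^esub> monomial x s = monomial x s \<otimes>\<^bsub>crossed_product\<^esub> r"
    if "s \<in> carrier G" "x \<in> D s" for s x
    using assms monomial_closed[OF that] by (simp add: ring_center_def)
  show "r (t \<otimes>\<^bsub>G\<^esub> inv\<^bsub>G\<^esub> s) \<otimes>\<^bsub>R\<^esub> twist (t \<otimes>\<^bsub>G\<^esub> inv\<^bsub>G\<^esub> s) s =
      \<alpha> s (r (inv\<^bsub>G\<^esub> s \<otimes>\<^bsub>G\<^esub> t) \<otimes>\<^bsub>R\<^esub> u (inv\<^bsub>G\<^esub> s)) \<otimes>\<^bsub>R\<^esub> twist s (inv\<^bsub>G\<^esub> s \<otimes>\<^bsub>G\<^esub> t)"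
    if s: "s \<in> carrier G" and t: "t \<in> carrier G"
  proof -
    let ?g = "t \<otimes>\<^bsub>G\<^esub> inv\<^bsub>G\<^esub> s" and ?h = "inv\<^bsub>G\<^esub> s \<otimes>\<^bsub>G\<^esub> t"
    let ?y = "\<alpha> s (r ?h \<otimes>\<^bsub>R\<^esub> u (inv\<^bsub>G\<^esub> s))"
    have g: "?g \<in> carrier G" "?g \<otimes>\<^bsub>G\<^esub> s = t" using s t by (simp_all add: G.m_assoc)
    have y: "?y \<in> D s" using s t r by (simp add: \<alpha>_closed restrict_closed)
    have tw: "twist ?g s \<in> D t" using twist_in_D[OF g(1) s] g(2) by simp
    have rg: "r ?g \<in> D ?g" using crossed_carrierD(1)[OF r g(1)] .
    \<comment> \<open>Both inserted idempotents are absorbed by their neighbours. Their product is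
      the value of \<open>\<alpha> ?g\<close> on \<open>u s\<close> times \<open>u (inv ?g)\<close>,
      which exposes the coefficient of a product with the monomial.\<close>
    have "r ?g \<otimes>\<^bsub>R\<^esub> twist ?g s = r ?g \<otimes>\<^bsub>R\<^esub> u ?g \<otimes>\<^bsub>R\<^esub> (u t \<otimes>\<^bsub>R\<^esub> twist ?g s)"
      using mult_u[OF g(1) rg] u_mult[OF t tw] by simp
    also have "\<dots> = r ?g \<otimes>\<^bsub>R\<^esub> (u ?g \<otimes>\<^bsub>R\<^esub> u t) \<otimes>\<^bsub>R\<^esub> twist ?g s"
      using g(1) s t r by (simp add: R.m_assoc del: G.m_closed)
    also have "u ?g \<otimes>\<^bsub>R\<^esub> u t = \<alpha> ?g (u s \<otimes>\<^bsub>R\<^esub> u (inv\<^bsub>G\<^esub> ?g))"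
      using \<alpha>_unit[OF g(1) s] g(2) by simp
    also have "r ?g \<otimes>\<^bsub>R\<^esub> \<dots> \<otimes>\<^bsub>R\<^esub> twist ?g s = (r \<otimes>\<^bsub>crossed_product\<^esub> monomial (u s) s) t"
      using mult_monomial(1)[OF r s u_in_D[OF s] t] by simp
    also have "\<dots> = u s \<otimes>\<^bsub>R\<^esub> ?y \<otimes>\<^bsub>R\<^esub> twist s ?h"
      using comm[OF s u_in_D[OF s]] mult_monomial(2)[OF r s u_in_D[OF s] t] by simp
    also have "\<dots> = ?y \<otimes>\<^bsub>R\<^esub> twist s ?h" using u_mult[OF s y] by simp
    finally show ?thesis .
  qed
  show "r s \<otimes>\<^bsub>R\<^esub> \<alpha> s (a \<otimes>\<^bsub>R\<^esub> u (inv\<^bsub>G\<^esub> s)) = a \<otimes>\<^bsub>R\<^esub> r s"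
    if a: "a \<in> carrier R" and s: "s \<in> carrier G"
  proof -
    have a': "a \<in> D \<one>\<^bsub>G\<^esub>" using a by (simp add: D_one)
    have rs: "r s \<in> D s" using crossed_carrierD(1)[OF r s] .
    have \<alpha>a: "\<alpha> s (a \<otimes>\<^bsub>R\<^esub> u (inv\<^bsub>G\<^esub> s)) \<in> D s" using a s by (simp add: \<alpha>_closed restrict_closed)
    \<comment> \<open>The inserted \<open>u s\<close> is the twist of \<open>s\<close> with the
      group identity, as the product formula demands.\<close>
    have "r s \<otimes>\<^bsub>R\<^esub> \<alpha> s (a \<otimes>\<^bsub>R\<^esub> u (inv\<^bsub>G\<^esub> s)) = r s \<otimes>\<^bsub>R\<^esub> \<alpha> s (a \<otimes>\<^bsub>R\<^esub> u (inv\<^bsub>G\<^esub> s)) \<otimes>\<^bsub>R\<^esub> u s"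
      using r s a mult_u[OF s \<alpha>a] by (simp add: R.m_assoc)
    also have "\<dots> = (r \<otimes>\<^bsub>crossed_product\<^esub> monomial a \<one>\<^bsub>G\<^esub>) s"
      using mult_monomial(1)[OF r G.one_closed a' s] s by (simp add: twist_one_right)
    also have "\<dots> = (monomial a \<one>\<^bsub>G\<^esub> \<otimes>\<^bsub>crossed_product\<^esub> r) s"
      using comm[OF G.one_closed a'] by simp
    \<comment> \<open>On this side the map at the group identity is trivial, and the twist is again
      \<open>u s\<close>.\<close>
    also have "\<dots> = a \<otimes>\<^bsub>R\<^esub> r s \<otimes>\<^bsub>R\<^esub> u s"
      using mult_monomial(2)[OF r G.one_closed a' s] s r by (simp add: twist_one_left u_one \<alpha>_one)
    also have "\<dots> = a \<otimes>\<^bsub>R\<^esub> r s" using r s a mult_u[OF s rs] by (simp add: R.m_assoc)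
    finally show ?thesis .
  qed
qed

text \<open>Both products are indexed by the support of the same factor \<open>a\<close>, from the
  right in one and from the left in the other. They share one index set, and it suffices to compare
  the summands at each \<open>h\<close>.\<close>

lemma conditions_imp_central:
  assumes r: "r \<in> carrier crossed_product"
    and tw: "\<And>s t. \<lbrakk>s \<in> carrier G; t \<in> carrier G\<rbrakk> \<Longrightarrow>
      r (t \<otimes>\<^bsub>G\<^esub> inv\<^bsub>G\<^esub> s) \<otimes>\<^bsub>R\<^esub> twist (t \<otimes>\<^bsub>G\<^esub> inv\<^bsub>G\<^esub> s) s =
      \<alpha> s (r (inv\<^bsub>G\<^esub> s \<otimes>\<^bsub>G\<^esub> t) \<otimes>\<^bsub>R\<^esub> u (inv\<^bsub>G\<^esub> s)) \<otimes>\<^bsub>R\<^esub> twist s (inv\<^bsub>G\<^esub> s \<otimes>\<^bsub>G\<^esub> t)"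
    and comm: "\<And>a s. \<lbrakk>a \<in> carrier R; s \<in> carrier G\<rbrakk> \<Longrightarrow>
      r s \<otimes>\<^bsub>R\<^esub> \<alpha> s (a \<otimes>\<^bsub>R\<^esub> u (inv\<^bsub>G\<^esub> s)) = a \<otimes>\<^bsub>R\<^esub> r s"
  shows "r \<in> ring_center crossed_product"
proof -
  have "r \<otimes>\<^bsub>crossed_product\<^esub> a = a \<otimes>\<^bsub>crossed_product\<^esub> r" if a: "a \<in> carrier crossed_product" for a
  proof (rule extensionalityI[where A = "carrier G"])
    fix k assume k: "k \<in> carrier G"
    have eq: "mult_term r a (k \<otimes>\<^bsub>G\<^esub> inv\<^bsub>G\<^esub> h) h = mult_term a r h (inv\<^bsub>G\<^esub> h \<otimes>\<^bsub>G\<^esub> k)"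
      if h: "h \<in> carrier G" for h
    proof -
      let ?g = "k \<otimes>\<^bsub>G\<^esub> inv\<^bsub>G\<^esub> h"
      have g: "?g \<in> carrier G" using k h by simp
      \<comment> \<open>The second condition, at \<open>?g\<close> with ring element
        \<open>a h\<close>, carries \<open>a h\<close> to the left of \<open>r ?g\<close>.\<close>
      have "mult_term r a ?g h = a h \<otimes>\<^bsub>R\<^esub> (r ?g \<otimes>\<^bsub>R\<^esub> twist ?g h)"
        using comm[OF crossed_coeff[OF a h] g] a r g h by (simp add: mult_term_def R.m_assoc del: G.m_closed)
      \<comment> \<open>The first condition, with \<open>h\<close> for \<open>s\<close> and
        \<open>k\<close> for \<open>t\<close>, replaces the remaining factor.\<close>
      also have "\<dots> = mult_term a r h (inv\<^bsub>G\<^esub> h \<otimes>\<^bsub>G\<^esub> k)"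
        using tw[OF h k] a r h k by (simp add: mult_term_def R.m_assoc)
      finally show ?thesis .
    qed
    have F: "finite (coeff_support G R a)" "coeff_support G R a \<subseteq> carrier G"
      using crossed_carrierD[OF a] by (auto simp: coeff_support_def)
    show "(r \<otimes>\<^bsub>crossed_product\<^esub> a) k = (a \<otimes>\<^bsub>crossed_product\<^esub> r) k"
      unfolding crossed_mult_right[OF r a k F(1) order_refl F(2)]
        crossed_mult_left[OF a r k F(1) order_refl F(2)]
      by (rule R.add.finprod_cong') (use F(2) eq a r k in auto)
  qed (simp_all add: partial_crossed_product_def)
  then show ?thesis using r by (simp add: ring_center_def)
qed

end

theorem lemma2p14:
  fixes G :: "('a, 'm) monoid_scheme" and R :: "('b, 'n) ring_scheme"
    and D :: "'a \<Rightarrow> 'b set" and \<alpha> :: "'a \<Rightarrow> 'b \<Rightarrow> 'b"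
    and w :: "'a \<Rightarrow> 'a \<Rightarrow> 'b multiplier" and u :: "'a \<Rightarrow> 'b"
  assumes "unital_twisted_partial_action G R D \<alpha> w u"
  shows "ring_center (partial_crossed_product G R D \<alpha> w) =
    {r \<in> carrier (partial_crossed_product G R D \<alpha> w).
      (\<forall>s\<in>carrier G. \<forall>t\<in>carrier G.
        r (t \<otimes>\<^bsub>G\<^esub> inv\<^bsub>G\<^esub> s) \<otimes>\<^bsub>R\<^esub> twist_elem G R u w (t \<otimes>\<^bsub>G\<^esub> inv\<^bsub>G\<^esub> s) s =
        \<alpha> s (r (inv\<^bsub>G\<^esub> s \<otimes>\<^bsub>G\<^esub> t) \<otimes>\<^bsub>R\<^esub> u (inv\<^bsub>G\<^esub> s)) \<otimes>\<^bsub>R\<^esub> twist_elem G R u w s (inv\<^bsub>G\<^esub> s \<otimes>\<^bsub>G\<^esub> t)) \<and>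
      (\<forall>a\<in>carrier R. \<forall>s\<in>carrier G.
        r s \<otimes>\<^bsub>R\<^esub> \<alpha> s (a \<otimes>\<^bsub>R\<^esub> u (inv\<^bsub>G\<^esub> s)) = a \<otimes>\<^bsub>R\<^esub> r s)}"
proof -
  interpret unital_twisted_partial_action G R D \<alpha> w u by fact
  show ?thesis
  proof (intro equalityI subsetI CollectI conjI ballI)
    fix r assume "r \<in> ring_center crossed_product"
    then show "r \<in> carrier crossed_product" by (simp add: ring_center_def)
  qed (use central_imp_conditions conditions_imp_central in \<open>blast+\<close>)
qed

end
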